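(* For all $\pi\in\mathcal S_n(321)$ we have $\mathsf E(\pi)=\mathsf D(\Phi(\pi))$, i.e. the excedance set of $\pi$ equals the descent set of $\Phi(\pi)$.
   Context: $\mathcal S_n$ is the symmetric group on $\{1,\dots,n\}$, with permutations written as words $\pi=\pi_1\cdots\pi_n$. $\mathcal S_n(\tau)$ is the set of permutations in $\mathcal S_n$ avoiding the pattern $\tau\in\mathcal S_k$, i.e. having no subsequence $\pi_{i_1}\cdots\pi_{i_k}$ ($i_1<\dots<i_k$) in the same relative order as $\tau_1\cdots\tau_k$. An excedance of $\pi$ is an $i\in\{1,\dots,n-1\}$ with $\pi_i>i$; $\mathsf E(\pi)$ is the set of excedances. A descent of $\pi$ is an $i\in\{1,\dots,n-1\}$ with $\pi_i>\pi_{i+1}$; $\mathsf D(\pi)$ is the set of descents. The diagram of $\sigma\in\mathcal S_n$ is $D(\sigma)=\{(i,j): j<\sigma_i,\ \sigma^{-1}(j)>i\}$ (rows $i$ numbered top to bottom, columns $j$ left to right). Let $\mathcal Y_n$ be the set of partitions $(\lambda_1,\dots,\lambda_{n-1})$, $\lambda_1\ge\dots\ge\lambda_{n-1}\ge0$, with $\lambda_i\le n-i$ for all $i$, identified with their Young diagrams $\{(i,j):1\le j\le\lambda_i\}$. The map $\sigma\mapsto D(\sigma)$ is a bijection from $\mathcal S_n(132)$ to $\mathcal Y_n$. A corner of a Young diagram is a square $(i,j)$ of it such that neither $(i+1,j)$ nor $(i,j+1)$ belongs to it. The bijection $\Phi:\mathcal S_n(321)\to\mathcal S_n(132)$: if $i_1<\dots<i_e$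 are the excedances of $\pi\in\mathcal S_n(321)$, then $\Phi(\pi)$ is the unique permutation in $\mathcal S_n(132)$ whose diagram is the Young diagram whose corners are exactly $(i_k,\,n+1-\pi_{i_k})$, $k=1,\dots,e$. *)

theory Defs
  imports Complex_Main "HOL-Combinatorics.Permutations"
begin

text \<open>
  A permutation \<open>\<pi>\<close> of \<open>{1..n}\<close> is a function with \<open>\<pi> permutes {1..n}\<close>; its word is
  \<open>\<pi> 1 \<dots> \<pi> n\<close>. Patterns are given by their words, as lists.
\<close>

definition contains_pattern :: "nat \<Rightarrow> (nat \<Rightarrow> nat) \<Rightarrow> nat list \<Rightarrow> bool" where
  "contains_pattern n \<pi> \<tau> \<longleftrightarrow>
     (\<exists>f. strict_mono_on {..<length \<tau>} f \<and> f ` {..<length \<tau>} \<subseteq> {1..n} \<and>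
          (\<forall>a<length \<tau>. \<forall>b<length \<tau>. \<pi> (f a) < \<pi> (f b) \<longleftrightarrow> \<tau> ! a < \<tau> ! b))"

definition avoiders :: "nat \<Rightarrow> nat list \<Rightarrow> (nat \<Rightarrow> nat) set" where
  "avoiders n \<tau> = {\<pi>. \<pi> permutes {1..n} \<and> \<not> contains_pattern n \<pi> \<tau>}"

definition excedances :: "nat \<Rightarrow> (nat \<Rightarrow> nat) \<Rightarrow> nat set" where
  "excedances n \<pi> = {i \<in> {1..n - 1}. \<pi> i > i}"

definition descents :: "nat \<Rightarrow> (nat \<Rightarrow> nat) \<Rightarrow> nat set" where
  "descents n \<pi> = {i \<in> {1..n - 1}. \<pi> i > \<pi> (i + 1)}"

definition diagram :: "nat \<Rightarrow> (nat \<Rightarrow> nat) \<Rightarrow> (nat \<times> nat) set" where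
  "diagram n \<sigma> = {(i, j). i \<in> {1..n} \<and> j \<in> {1..n} \<and> j < \<sigma> i \<and> inv \<sigma> j > i}"

definition young_diagram :: "nat \<Rightarrow> (nat \<Rightarrow> nat) \<Rightarrow> (nat \<times> nat) set" where
  "young_diagram m lam = {(i, j). i \<in> {1..m} \<and> 1 \<le> j \<and> j \<le> lam i}"

text \<open>
  Partitions \<open>(lam 1, \<dots>, lam (n - 1))\<close> below the staircase, identified with their Young
  diagrams; values of \<open>lam\<close> outside \<open>{1..n - 1}\<close> do not enter the diagram.
\<close>

definition staircase_diagrams :: "nat \<Rightarrow> (nat \<times> nat) set set" where
  "staircase_diagrams n =
     {young_diagram (n - 1) lam | lam.
        antimono_on {1..n - 1} lam \<and> (\<forall>i \<in> {1..n - 1}. lam i \<le> n - i)}"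

definition corners :: "(nat \<times> nat) set \<Rightarrow> (nat \<times> nat) set" where
  "corners Y = {(i, j). (i, j) \<in> Y \<and> (i + 1, j) \<notin> Y \<and> (i, j + 1) \<notin> Y}"

text \<open>
  Meaningful for \<open>\<pi> \<in> avoiders n [3, 2, 1]\<close>, where such a \<open>\<sigma>\<close> exists and is unique. The
  truncated subtraction is harmless since then \<open>\<pi> i \<le> n\<close>.
\<close>

definition Phi :: "nat \<Rightarrow> (nat \<Rightarrow> nat) \<Rightarrow> (nat \<Rightarrow> nat)" where
  "Phi n \<pi> = (THE \<sigma>. \<sigma> \<in> avoiders n [1, 3, 2] \<and>
     (\<exists>Y \<in> staircase_diagrams n.
        corners Y = {(i, n + 1 - \<pi> i) | i. i \<in> excedances n \<pi>} \<and> diagram n \<sigma> = Y))"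

end

theory Submission imports Defs begin

text \<open>
  Two correspondences make \<open>Phi\<close> well defined. A Young diagram is the set of squares lying weakly
  north-west of at least one of its corners, so it is determined by them
  (\<open>staircase_diagram_eq_if_corners_eq\<close>). A permutation can be read off from its diagram
  from left to right, because the row \<open>i\<close> lists the values below \<open>\<sigma> i\<close> not yet used by the positions up to \<open>i\<close>
  (\<open>eq_if_diagram_eq\<close>); conversely, for every partition below the staircase the
  greedy choice ``least unused value exceeding \<open>lam i\<close>'' yields a permutation with that diagram,
  and it avoids 132 (\<open>ex_avoider_with_diagram\<close>). In a 321-avoiding permutation the excedance values
  increase from left to right (\<open>excedance_values_increasing\<close>), so the squares \<open>(i, n + 1 - \<pi> i)\<close>
  form a staircase going up to the right, which is exactly the shape that the corners of a Young
  diagram can have (\<open>ex_staircase_diagram_with_excedance_corners\<close>).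

  The theorem then reduces to one observation about \<open>\<sigma> = Phi n \<pi>\<close>: the row \<open>i\<close> of the diagram of
  \<open>\<sigma>\<close> is strictly longer than the row \<open>i + 1\<close> if and only if \<open>i\<close> is a descent of \<open>\<sigma>\<close>. In a Young
  diagram these are the rows that contain a corner (\<open>descents_eq_corner_rows\<close>), and the rows of the
  corners were chosen to be the excedances of \<open>\<pi>\<close>.
\<close>

section \<open>Patterns of length three\<close>

lemma contains_pattern_3I:
  assumes "1 \<le> p" "p < q" "q < r" "r \<le> n"
    and "\<pi> p < \<pi> q \<longleftrightarrow> x < y" "\<pi> q < \<pi> p \<longleftrightarrow> y < x"
    and "\<pi> p < \<pi> r \<longleftrightarrow> x < z" "\<pi> r < \<pi> p \<longleftrightarrow> z < x"
    and "\<pi> q < \<pi> r \<longleftrightarrow> y < z" "\<pi> r < \<pi> q \<longleftrightarrow> z < y"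
  shows "contains_pattern n \<pi> [x, y, z]"
proof -
  have three: "a < 3 \<longleftrightarrow> a = 0 \<or> a = 1 \<or> a = 2" for a :: nat
    by auto
  let ?f = "(!) [p, q, r]"
  have "strict_mono_on {..<3} ?f"
    using assms(2,3) by (auto simp: strict_mono_on_def three)
  moreover have "?f ` {..<3} \<subseteq> {1..n}"
    using assms(1-4) by (auto simp: three)
  moreover have "\<forall>a<3. \<forall>b<3. \<pi> (?f a) < \<pi> (?f b) \<longleftrightarrow> [x, y, z] ! a < [x, y, z] ! b"
    using assms(5-10) by (simp add: three all_conj_distrib imp_disjL)
  ultimately show ?thesis
    unfolding contains_pattern_def by (intro exI[of _ ?f]) (simp add: numeral_3_eq_3)
qed

lemma contains_pattern_3E:
  assumes "contains_pattern n \<pi> [x, y, z]"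
  obtains p q r where "1 \<le> p" "p < q" "q < r" "r \<le> n"
    and "\<pi> p < \<pi> q \<longleftrightarrow> x < y" "\<pi> p < \<pi> r \<longleftrightarrow> x < z" "\<pi> r < \<pi> q \<longleftrightarrow> z < y"
proof -
  obtain f where f: "strict_mono_on {..<3} f" "f ` {..<3} \<subseteq> {1..n}"
    and ord: "\<And>a b. a < 3 \<Longrightarrow> b < 3 \<Longrightarrow> \<pi> (f a) < \<pi> (f b) \<longleftrightarrow> [x, y, z] ! a < [x, y, z] ! b"
    using assms unfolding contains_pattern_def by (auto simp: numeral_3_eq_3)
  have "f 0 < f 1" "f 1 < f 2"
    using f(1) by (auto simp: strict_mono_on_def)
  moreover have "1 \<le> f 0" "f 2 \<le> n"
    using f(2) by (auto simp: image_subset_iff)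
  ultimately show thesis
    using that[of "f 0" "f 1" "f 2"] ord[of 0 1] ord[of 0 2] ord[of 2 1] by simp
qed


section \<open>Young diagrams and their corners\<close>

text \<open>
  Downward closure and the bounds of the next lemma replace the partition in all arguments about
  corners.
\<close>

lemma staircase_diagram_downward_closed:
  assumes "Y \<in> staircase_diagrams n" "(i, j) \<in> Y" "1 \<le> i'" "i' \<le> i" "1 \<le> j'" "j' \<le> j"
  shows "(i', j') \<in> Y"
proof -
  obtain lam where lam: "antimono_on {1..n - 1} lam" "Y = young_diagram (n - 1) lam"
    using assms(1) unfolding staircase_diagrams_def by auto
  have "i \<in> {1..n - 1}" "j \<le> lam i"
    using assms(2) lam(2) by (auto simp: young_diagram_def)
  moreover from this have "lam i \<le> lam i'"
    using lam(1) assms(3,4) by (auto simp: monotone_on_def)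
  ultimately show ?thesis
    using assms(3-6) lam(2) by (auto simp: young_diagram_def)
qed

lemma staircase_diagram_bounds:
  assumes "Y \<in> staircase_diagrams n" "(i, j) \<in> Y"
  shows "1 \<le> i" "1 \<le> j" "i + j \<le> n"
proof -
  obtain lam where lam: "\<forall>i \<in> {1..n - 1}. lam i \<le> n - i" "Y = young_diagram (n - 1) lam"
    using assms(1) unfolding staircase_diagrams_def by auto
  then have "1 \<le> i" "i \<le> n - 1" "1 \<le> j" "j \<le> n - i"
    using assms(2) by (auto simp: young_diagram_def intro: order_trans)
  then show "1 \<le> i" "1 \<le> j" "i + j \<le> n" by auto
qed

text \<open>
  From any square one reaches a corner by stepping down or right as long as this is possible: the
  sum of the coordinates is bounded.
\<close>

lemma ex_corner_south_east:
  assumes "Y \<in> staircase_diagrams n" "(i, j) \<in> Y"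
  shows "\<exists>(i', j') \<in> corners Y. i \<le> i' \<and> j \<le> j'"
  using assms(2)
proof (induction "n - (i + j)" arbitrary: i j rule: less_induct)
  case less
  show ?case
  proof (cases "(i, j) \<in> corners Y")
    case False
    then consider "(i + 1, j) \<in> Y" | "(i, j + 1) \<in> Y"
      using less.prems by (auto simp: corners_def)
    then show ?thesis
    proof cases
      case 1
      have "n - ((i + 1) + j) < n - (i + j)"
        using staircase_diagram_bounds(3)[OF assms(1) 1] by simp
      from less.hyps[OF this 1] show ?thesis
        by (auto intro: Suc_leD)
    next
      case 2
      have "n - (i + (j + 1)) < n - (i + j)"
        using staircase_diagram_bounds(3)[OF assms(1) 2] by simp
      from less.hyps[OF this 2] show ?thesis
        by (auto intro: Suc_leD)
    qed
  qed auto
qed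

lemma staircase_diagram_subset_if_corners_eq:
  assumes "Y \<in> staircase_diagrams n" "Z \<in> staircase_diagrams n" "corners Y = corners Z"
  shows "Y \<subseteq> Z"
proof (clarify)
  fix i j assume ij: "(i, j) \<in> Y"
  then obtain i' j' where "(i', j') \<in> corners Z" "i \<le> i'" "j \<le> j'"
    using ex_corner_south_east[OF assms(1) ij] assms(3) by auto
  moreover have "1 \<le> i" "1 \<le> j"
    using staircase_diagram_bounds[OF assms(1) ij] by auto
  ultimately show "(i, j) \<in> Z"
    using staircase_diagram_downward_closed[OF assms(2), of i' j' i j] by (auto simp: corners_def)
qed

lemma staircase_diagram_eq_if_corners_eq:
  assumes "Y \<in> staircase_diagrams n" "Z \<in> staircase_diagrams n" "corners Y = corners Z"
  shows "Y = Z"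
  using staircase_diagram_subset_if_corners_eq assms by (metis subset_antisym)


section \<open>Permutations and their diagrams\<close>

lemma mem_diagram_iff:
  assumes "\<sigma> permutes {1..n}"
  shows "(i, j) \<in> diagram n \<sigma> \<longleftrightarrow> (\<exists>k. 1 \<le> i \<and> i < k \<and> k \<le> n \<and> j = \<sigma> k \<and> \<sigma> k < \<sigma> i)"
proof
  assume "(i, j) \<in> diagram n \<sigma>"
  then have "i \<in> {1..n}" "j \<in> {1..n}" "j < \<sigma> i" "i < inv \<sigma> j"
    by (auto simp: diagram_def)
  moreover have "inv \<sigma> j \<in> {1..n}"
    using permutes_in_image[OF permutes_inv[OF assms]] \<open>j \<in> {1..n}\<close> by blast
  ultimately show "\<exists>k. 1 \<le> i \<and> i < k \<and> k \<le> n \<and> j = \<sigma> k \<and> \<sigma> k < \<sigma> i"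
    using permutes_inverses(1)[OF assms] by (intro exI[of _ "inv \<sigma> j"]) auto
next
  assume "\<exists>k. 1 \<le> i \<and> i < k \<and> k \<le> n \<and> j = \<sigma> k \<and> \<sigma> k < \<sigma> i"
  then obtain k where k: "1 \<le> i" "i < k" "k \<le> n" "j = \<sigma> k" "\<sigma> k < \<sigma> i" by blast
  then have "j \<in> {1..n}"
    using permutes_in_image[OF assms, of k] by auto
  then show "(i, j) \<in> diagram n \<sigma>"
    using k permutes_inverses(2)[OF assms] by (auto simp: diagram_def)
qed

text \<open>
  At the first position where two permutations differ, the smaller of the two values is still to
  come in the other permutation, hence gives a square of that diagram only. The lemma is stated
  asymmetrically, so that it excludes both orders of the two values.
\<close>

lemma not_less_if_diagram_eq:
  assumes "\<sigma> permutes {1..n}" "\<tau> permutes {1..n}" "diagram n \<sigma> = diagram n \<tau>"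
    and i: "i \<in> {1..n}" and eq: "\<And>k. k < i \<Longrightarrow> \<sigma> k = \<tau> k"
  shows "\<not> \<sigma> i < \<tau> i"
proof
  assume less: "\<sigma> i < \<tau> i"
  have "\<sigma> i \<in> \<tau> ` {1..n}"
    using i permutes_in_image[OF assms(1)] permutes_image[OF assms(2)] by simp
  then obtain k where k: "k \<in> {1..n}" "\<tau> k = \<sigma> i" by auto
  have "\<not> k < i"
    using eq[of k] k(2) permutes_inj[OF assms(1)] by (metis injD less_irrefl)
  moreover have "k \<noteq> i"
    using less k(2) by auto
  ultimately have "(i, \<sigma> i) \<in> diagram n \<tau>"
    using k i less by (auto simp: mem_diagram_iff[OF assms(2)] intro!: exI[of _ k])
  then show False
    using assms(3) by (auto simp: mem_diagram_iff[OF assms(1), symmetric] diagram_def)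
qed

lemma eq_if_diagram_eq:
  assumes "\<sigma> permutes {1..n}" "\<tau> permutes {1..n}" "diagram n \<sigma> = diagram n \<tau>"
  shows "\<sigma> = \<tau>"
proof
  fix i show "\<sigma> i = \<tau> i"
  proof (induction i rule: less_induct)
    case (less i)
    show ?case
    proof (cases "i \<in> {1..n}")
      case True
      then show ?thesis
        using not_less_if_diagram_eq[OF assms True] less
          not_less_if_diagram_eq[OF assms(2,1) assms(3)[symmetric] True]
        by (metis linorder_neqE_nat)
    next
      case False
      then show ?thesis
        using assms(1,2) by (simp add: permutes_def)
    qed
  qed
qed

text \<open>
  An occurrence of 132 at positions \<open>p < q < r\<close> puts the square \<open>(q, \<sigma> r)\<close> into the diagram, but
  leaves the square \<open>(p, \<sigma> r)\<close> above it out.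
\<close>

lemma avoids_132_if_diagram_staircase:
  assumes "\<sigma> permutes {1..n}" "diagram n \<sigma> \<in> staircase_diagrams n"
  shows "\<sigma> \<in> avoiders n [1, 3, 2]"
proof -
  have "\<not> contains_pattern n \<sigma> [1, 3, 2]"
  proof
    assume "contains_pattern n \<sigma> [1, 3, 2]"
    then obtain p q r where pqr: "1 \<le> p" "p < q" "q < r" "r \<le> n"
      and "\<sigma> p < \<sigma> q \<longleftrightarrow> (1::nat) < 3" "\<sigma> p < \<sigma> r \<longleftrightarrow> (1::nat) < 2" "\<sigma> r < \<sigma> q \<longleftrightarrow> (2::nat) < 3"
      by (rule contains_pattern_3E)
    then have less: "\<sigma> p < \<sigma> r" "\<sigma> r < \<sigma> q" by auto
    have "(q, \<sigma> r) \<in> diagram n \<sigma>"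
      using pqr less by (auto simp: mem_diagram_iff[OF assms(1)])
    moreover from this have "1 \<le> \<sigma> r"
      using staircase_diagram_bounds[OF assms(2)] by blast
    ultimately have "(p, \<sigma> r) \<in> diagram n \<sigma>"
      using staircase_diagram_downward_closed[OF assms(2)] pqr by fastforce
    then show False
      using less by (simp add: diagram_def)
  qed
  then show ?thesis
    using assms(1) by (simp add: avoiders_def)
qed

text \<open>
  If \<open>i\<close> is a descent, then the square \<open>(i, \<sigma> (i + 1))\<close> lies in the diagram and the one below it does
  not, so that the last square of the row \<open>i\<close> is a corner. If \<open>i\<close> is not a descent, then every value
  counted in the row \<open>i\<close> is smaller than \<open>\<sigma> (i + 1)\<close> and comes after it, so it is counted
  in the row \<open>i + 1\<close> too.
\<close>

lemma descents_eq_corner_rows: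
  assumes \<sigma>: "\<sigma> permutes {1..n}" and Y: "diagram n \<sigma> \<in> staircase_diagrams n"
  shows "descents n \<sigma> = fst ` corners (diagram n \<sigma>)"
proof (intro equalityI subsetI)
  fix i assume "i \<in> descents n \<sigma>"
  then have i: "1 \<le> i" "i + 1 \<le> n" "\<sigma> (i + 1) < \<sigma> i"
    by (auto simp: descents_def)
  then have "(i, \<sigma> (i + 1)) \<in> diagram n \<sigma>"
    by (auto simp: mem_diagram_iff[OF \<sigma>])
  then obtain i' j' where c: "(i', j') \<in> corners (diagram n \<sigma>)" "i \<le> i'" "\<sigma> (i + 1) \<le> j'"
    and pos: "1 \<le> \<sigma> (i + 1)"
    using ex_corner_south_east[OF Y] staircase_diagram_bounds(2)[OF Y] by blast
  have "\<not> i + 1 \<le> i'"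
  proof
    assume "i + 1 \<le> i'"
    then have "(i + 1, \<sigma> (i + 1)) \<in> diagram n \<sigma>"
      using c pos staircase_diagram_downward_closed[OF Y, of i' j'] by (auto simp: corners_def)
    then show False by (simp add: diagram_def)
  qed
  then have "i' = i" using c(2) by simp
  then show "i \<in> fst ` corners (diagram n \<sigma>)"
    using c(1) by force
next
  fix i assume "i \<in> fst ` corners (diagram n \<sigma>)"
  then obtain j where j: "(i, j) \<in> diagram n \<sigma>" "(i + 1, j) \<notin> diagram n \<sigma>"
    by (auto simp: corners_def)
  then obtain k where k: "1 \<le> i" "i < k" "k \<le> n" "j = \<sigma> k" "\<sigma> k < \<sigma> i"
    by (auto simp: mem_diagram_iff[OF \<sigma>])
  have "\<sigma> (i + 1) < \<sigma> i"
  proof (cases "k = i + 1")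
    case False
    then have "\<not> \<sigma> k < \<sigma> (i + 1)"
      using j(2) k by (auto simp: mem_diagram_iff[OF \<sigma>])
    then show ?thesis using k(5) by simp
  qed (use k in simp)
  then show "i \<in> descents n \<sigma>"
    using k by (auto simp: descents_def)
qed


section \<open>A permutation with prescribed diagram\<close>

text \<open>
  For antitone \<open>lam\<close>, the numbers \<open>1, \<dots>, lam i\<close> are exactly the values below the chosen one that
  remain for later positions: none of them has been used before, since earlier values exceed
  earlier, hence no smaller, bounds, and the unused values above \<open>lam i\<close> start with the chosen one.
  So this rule realises a prescribed row length \<open>lam i\<close> of the diagram.
\<close>

fun greedy :: "(nat \<Rightarrow> nat) \<Rightarrow> nat \<Rightarrow> nat" where
  "greedy lam i = (LEAST v. lam i < v \<and> v \<notin> greedy lam ` {1..<i})"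

declare greedy.simps [simp del]

lemma greedy_least:
  assumes "lam i < v" "v \<notin> greedy lam ` {1..<i}"
  shows "greedy lam i \<le> v"
  unfolding greedy.simps[of lam i] using assms by (intro Least_le) simp

text \<open>
  The staircase condition leaves at least \<open>i\<close> candidates, of which at most \<open>i - 1\<close> are taken.
\<close>

lemma greedy_ex:
  assumes "lam i + i \<le> n" "1 \<le> i"
  shows "\<exists>v \<le> n. lam i < v \<and> v \<notin> greedy lam ` {1..<i}"
proof (rule ccontr)
  assume "\<not> ?thesis"
  then have "{lam i<..n} \<subseteq> greedy lam ` {1..<i}" by auto
  then have "card {lam i<..n} \<le> card {1..<i}"
    by (meson card_image_le card_mono finite_atLeastLessThan finite_imageI le_trans)
  then show False using assms by simp
qed

lemma greedy_props:
  assumes "lam i + i \<le> n" "1 \<le> i"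
  shows "lam i < greedy lam i" "greedy lam i \<notin> greedy lam ` {1..<i}" "greedy lam i \<le> n"
proof -
  obtain v where v: "v \<le> n" "lam i < v" "v \<notin> greedy lam ` {1..<i}"
    using greedy_ex[of lam i n, OF assms] by blast
  have "lam i < greedy lam i \<and> greedy lam i \<notin> greedy lam ` {1..<i}"
    unfolding greedy.simps[of lam i] by (rule LeastI[of _ v]) (use v in simp)
  then show "lam i < greedy lam i" "greedy lam i \<notin> greedy lam ` {1..<i}" by auto
  show "greedy lam i \<le> n"
    using greedy_least[OF v(2,3)] v(1) by simp
qed

lemma ex_avoider_with_diagram:
  assumes "Y \<in> staircase_diagrams n"
  shows "\<exists>\<sigma> \<in> avoiders n [1, 3, 2]. diagram n \<sigma> = Y"
proof -
  obtain lam where anti: "antimono_on {1..n - 1} lam" and le: "\<forall>i \<in> {1..n - 1}. lam i \<le> n - i"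
    and Y: "Y = young_diagram (n - 1) lam"
    using assms unfolding staircase_diagrams_def by auto
  \<comment> \<open>A permutation of \<open>{1..n}\<close> has \<open>n\<close> rows, so the partition is padded by an empty row \<open>n\<close>.\<close>
  define \<mu> where "\<mu> i = (if i \<le> n - 1 then lam i else 0)" for i
  have sum: "\<mu> i + i \<le> n" if "i \<in> {1..n}" for i
  proof (cases "i \<le> n - 1")
    case True
    then have "\<mu> i \<le> n - i" using le that by (simp add: \<mu>_def)
    moreover have "i \<le> n" using that by simp
    ultimately show ?thesis by linarith
  qed (use that in \<open>simp add: \<mu>_def\<close>)
  have anti: "\<mu> b \<le> \<mu> a" if "1 \<le> a" "a \<le> b" for a b
    using anti that by (auto simp: \<mu>_def monotone_on_def)
  define \<sigma> where "\<sigma> i = (if i \<in> {1..n} then greedy \<mu> i else i)" for i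
  have above: "\<mu> i < \<sigma> i" and bound: "\<sigma> i \<le> n" if "i \<in> {1..n}" for i
    using greedy_props[of \<mu> i n, OF sum[OF that]] that by (auto simp: \<sigma>_def)
  have distinct: "\<sigma> a \<noteq> \<sigma> b" if "1 \<le> a" "a < b" "b \<le> n" for a b
  proof -
    have "greedy \<mu> b \<notin> greedy \<mu> ` {1..<b}"
      using greedy_props(2)[of \<mu> b n, OF sum] that by simp
    moreover have "greedy \<mu> a \<in> greedy \<mu> ` {1..<b}"
      using that by simp
    ultimately have "greedy \<mu> a \<noteq> greedy \<mu> b" by metis
    then show ?thesis using that by (simp add: \<sigma>_def)
  qed
  have inj: "inj_on \<sigma> {1..n}"
    by (rule linorder_inj_onI) (use distinct in auto)
  have "\<sigma> ` {1..n} \<subseteq> {1..n}"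
    using above bound by fastforce
  then have "bij_betw \<sigma> {1..n} {1..n}"
    using inj endo_inj_surj[of "{1..n}" \<sigma>] by (simp add: bij_betw_def)
  then have perm: "\<sigma> permutes {1..n}"
    by (rule bij_imp_permutes) (auto simp: \<sigma>_def)
  have mem: "(i, j) \<in> diagram n \<sigma> \<longleftrightarrow> (i, j) \<in> Y" for i j
  proof
    assume "(i, j) \<in> diagram n \<sigma>"
    then obtain k where k: "1 \<le> i" "i < k" "k \<le> n" "j = \<sigma> k" "\<sigma> k < \<sigma> i"
      by (auto simp: mem_diagram_iff[OF perm])
    have "j \<noteq> greedy \<mu> a" if "a \<in> {1..<i}" for a
      using distinct[of a k] k that by (auto simp: \<sigma>_def)
    then have "j \<notin> greedy \<mu> ` {1..<i}" by blast
    moreover have "j < greedy \<mu> i"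
      using k by (simp add: \<sigma>_def split: if_splits)
    ultimately have "j \<le> \<mu> i"
      using greedy_least[of \<mu> i j] by fastforce
    moreover have "1 \<le> j"
      using above[of k] k by simp
    ultimately show "(i, j) \<in> Y"
      using k by (auto simp: Y young_diagram_def \<mu>_def split: if_splits)
  next
    assume "(i, j) \<in> Y"
    then have i: "1 \<le> i" "i \<le> n - 1" and j: "1 \<le> j" "j \<le> \<mu> i"
      by (auto simp: Y young_diagram_def \<mu>_def)
    have "i \<le> n"
      using i(2) diff_le_self le_trans by blast
    then have i_mem: "i \<in> {1..n}"
      using i(1) by simp
    then have "j \<in> {1..n}"
      using sum[of i] j by simp
    then have "j \<in> \<sigma> ` {1..n}"
      by (simp only: permutes_image[OF perm])
    then obtain k where k: "k \<in> {1..n}" "\<sigma> k = j" by (elim imageE) simp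
    have "\<not> k \<le> i"
    proof
      assume "k \<le> i"
      then have "j \<le> \<mu> k"
        using anti[of k i] k(1) j(2) by simp
      then show False
        using above[OF k(1)] k(2) by simp
    qed
    moreover have "j < \<sigma> i"
      using above[OF i_mem] j by simp
    ultimately show "(i, j) \<in> diagram n \<sigma>"
      using i k by (auto simp: mem_diagram_iff[OF perm] intro!: exI[of _ k])
  qed
  then have "diagram n \<sigma> = Y" by auto
  then show ?thesis
    using avoids_132_if_diagram_staircase[OF perm] assms by blast
qed


section \<open>Excedances of 321-avoiding permutations\<close>

text \<open>
  If \<open>\<pi> b > b\<close>, then the positions up to \<open>b\<close> cannot take all of the values up to \<open>b\<close>, so one of
  these comes later; together with a decrease from \<open>a\<close> to \<open>b\<close> it would complete a 321 pattern.
\<close>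

lemma excedance_values_increasing:
  assumes "\<pi> \<in> avoiders n [3, 2, 1]" "a \<in> excedances n \<pi>" "b \<in> excedances n \<pi>" "a < b"
  shows "\<pi> a < \<pi> b"
proof (rule ccontr)
  assume "\<not> \<pi> a < \<pi> b"
  have perm: "\<pi> permutes {1..n}" and avoid: "\<not> contains_pattern n \<pi> [3, 2, 1]"
    using assms(1) by (auto simp: avoiders_def)
  have "\<pi> a \<noteq> \<pi> b"
    using permutes_inj[OF perm] \<open>a < b\<close> by (metis injD less_irrefl)
  with \<open>\<not> \<pi> a < \<pi> b\<close> have ba: "\<pi> b < \<pi> a" by simp
  have a: "1 \<le> a" and b: "b \<in> {1..n - 1}" "b < \<pi> b"
    using assms(2,3) by (auto simp: excedances_def)
  have "\<exists>c \<in> {1..n}. b < c \<and> \<pi> c \<le> b"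
  proof (rule ccontr)
    assume neg: "\<not> ?thesis"
    have "{1..b} \<subseteq> \<pi> ` {1..<b}"
    proof
      fix v assume v: "v \<in> {1..b}"
      then have "v \<in> \<pi> ` {1..n}"
        using b permutes_image[OF perm] by auto
      then obtain c where c: "c \<in> {1..n}" "v = \<pi> c" by auto
      then have "c \<noteq> b" "\<not> b < c"
        using neg v b by auto
      then show "v \<in> \<pi> ` {1..<b}"
        using c by auto
    qed
    then have "card {1..b} \<le> card {1..<b}"
      by (meson card_image_le card_mono finite_atLeastLessThan finite_imageI le_trans)
    then have "b \<le> b - 1" by simp
    moreover have "1 \<le> b" using b(1) by simp
    ultimately show False by linarith
  qed
  then obtain c where "c \<in> {1..n}" "b < c" "\<pi> c \<le> b" by blast
  then have "contains_pattern n \<pi> [3, 2, 1]"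
    using a b ba \<open>a < b\<close> by (intro contains_pattern_3I[of a b c]) auto
  with avoid show False ..
qed

text \<open>
  The rows are as short as the prescribed squares permit: row \<open>i\<close> has to reach the columns of
  all prescribed squares in the rows from \<open>i\<close> on. Since excedance values increase, the first of
  these squares is the rightmost one, so a row is longer than the next one exactly at excedances.
\<close>

lemma ex_staircase_diagram_with_excedance_corners:
  assumes "\<pi> \<in> avoiders n [3, 2, 1]"
  shows "\<exists>Y \<in> staircase_diagrams n. corners Y = {(i, n + 1 - \<pi> i) | i. i \<in> excedances n \<pi>}"
proof -
  have perm: "\<pi> permutes {1..n}"
    using assms by (simp add: avoiders_def)
  have exc: "1 \<le> k" "k \<le> n - 1" "k < \<pi> k" "\<pi> k \<le> n" if "k \<in> excedances n \<pi>" for k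
    using that permutes_in_image[OF perm, of k] by (auto simp: excedances_def)
  define Y where
    "Y = {(i, j). 1 \<le> i \<and> 1 \<le> j \<and> (\<exists>k \<in> excedances n \<pi>. i \<le> k \<and> j \<le> n + 1 - \<pi> k)}"
  define S where "S i = {n + 1 - \<pi> k | k. k \<in> excedances n \<pi> \<and> i \<le> k}" for i
  \<comment> \<open>Inserting 0 makes the maximum meaningful for rows below the last excedance.\<close>
  define lam where "lam i = Max (insert 0 (S i))" for i
  have fin: "finite (S i)" for i
    by (auto simp: S_def excedances_def)
  have le_lam: "j \<le> lam i \<longleftrightarrow> (\<exists>k \<in> excedances n \<pi>. i \<le> k \<and> j \<le> n + 1 - \<pi> k)"
    if "1 \<le> j" for i j
    using that fin[of i] by (auto simp: lam_def Max_ge_iff S_def)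
  have "Y = young_diagram (n - 1) lam"
    using exc(2) by (fastforce simp: Y_def young_diagram_def le_lam)
  moreover have "antimono_on {1..n - 1} lam"
  proof -
    have "S b \<subseteq> S a" if "a \<le> b" for a b
      using that by (auto simp: S_def)
    then show ?thesis
      using fin unfolding monotone_on_def lam_def by (intro ballI impI Max_mono) auto
  qed
  moreover have "lam i \<le> n - i" for i
    using fin exc(3) by (fastforce simp: lam_def S_def)
  ultimately have "Y \<in> staircase_diagrams n"
    unfolding staircase_diagrams_def by blast
  moreover have "corners Y = {(i, n + 1 - \<pi> i) | i. i \<in> excedances n \<pi>}"
  proof (intro equalityI subsetI)
    fix x assume "x \<in> corners Y"
    then obtain i j where x: "x = (i, j)" and ij: "(i, j) \<in> Y" "(i + 1, j) \<notin> Y" "(i, j + 1) \<notin> Y"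
      by (auto simp: corners_def)
    then obtain k where k: "k \<in> excedances n \<pi>" "i \<le> k" "j \<le> n + 1 - \<pi> k" "1 \<le> i" "1 \<le> j"
      by (auto simp: Y_def)
    have "k = i"
      using ij(2) k by (fastforce simp: Y_def)
    moreover have "j = n + 1 - \<pi> k"
      using ij(3) k by (fastforce simp: Y_def)
    ultimately show "x \<in> {(i, n + 1 - \<pi> i) | i. i \<in> excedances n \<pi>}"
      using k x by blast
  next
    fix x assume "x \<in> {(i, n + 1 - \<pi> i) | i. i \<in> excedances n \<pi>}"
    then obtain i where i: "i \<in> excedances n \<pi>" and x: "x = (i, n + 1 - \<pi> i)" by blast
    have less: "n + 1 - \<pi> k < n + 1 - \<pi> i" if "k \<in> excedances n \<pi>" "i < k" for k
      using excedance_values_increasing[OF assms i that] exc(4)[OF that(1)] by simp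
    have "(i, n + 1 - \<pi> i) \<in> Y"
      using i exc[OF i] by (auto simp: Y_def)
    moreover have "(i + 1, n + 1 - \<pi> i) \<notin> Y"
      using less by (fastforce simp: Y_def)
    moreover have "(i, n + 1 - \<pi> i + 1) \<notin> Y"
    proof
      assume "(i, n + 1 - \<pi> i + 1) \<in> Y"
      then obtain k where k: "k \<in> excedances n \<pi>" "i \<le> k" "n + 1 - \<pi> i + 1 \<le> n + 1 - \<pi> k"
        by (auto simp: Y_def)
      then show False
        using less[OF k(1)] by (cases "k = i") auto
    qed
    ultimately show "x \<in> corners Y"
      by (simp add: corners_def x)
  qed
  ultimately show ?thesis by blast
qed


section \<open>Excedances and descents\<close>

lemma Phi_props:
  assumes "\<pi> \<in> avoiders n [3, 2, 1]"
  shows "Phi n \<pi> permutes {1..n}" "diagram n (Phi n \<pi>) \<in> staircase_diagrams n"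
    and "corners (diagram n (Phi n \<pi>)) = {(i, n + 1 - \<pi> i) | i. i \<in> excedances n \<pi>}"
proof -
  let ?C = "{(i, n + 1 - \<pi> i) | i. i \<in> excedances n \<pi>}"
  let ?P = "\<lambda>\<sigma>. \<sigma> \<in> avoiders n [1, 3, 2] \<and>
     (\<exists>Y \<in> staircase_diagrams n. corners Y = ?C \<and> diagram n \<sigma> = Y)"
  obtain Y where Y: "Y \<in> staircase_diagrams n" "corners Y = ?C"
    using ex_staircase_diagram_with_excedance_corners[OF assms] by blast
  then obtain \<sigma> where \<sigma>: "\<sigma> \<in> avoiders n [1, 3, 2]" "diagram n \<sigma> = Y"
    using ex_avoider_with_diagram by blast
  have "?P (Phi n \<pi>)"
    unfolding Phi_def
  proof (rule theI[of ?P])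
    show "?P \<sigma>" using Y \<sigma> by blast
  next
    fix \<tau> assume \<tau>: "?P \<tau>"
    then have "diagram n \<tau> = Y"
      using Y staircase_diagram_eq_if_corners_eq by metis
    then show "\<tau> = \<sigma>"
      using \<tau> \<sigma> eq_if_diagram_eq by (auto simp: avoiders_def)
  qed
  then show "Phi n \<pi> permutes {1..n}" "diagram n (Phi n \<pi>) \<in> staircase_diagrams n"
    "corners (diagram n (Phi n \<pi>)) = ?C"
    by (auto simp: avoiders_def)
qed

theorem proposition2p4:
  fixes n :: nat and \<pi> :: "nat \<Rightarrow> nat"
  assumes "\<pi> \<in> avoiders n [3, 2, 1]"
  shows "excedances n \<pi> = descents n (Phi n \<pi>)"
proof -
  have "descents n (Phi n \<pi>) = fst ` {(i, n + 1 - \<pi> i) | i. i \<in> excedances n \<pi>}"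
    using descents_eq_corner_rows[OF Phi_props(1,2)[OF assms]] Phi_props(3)[OF assms] by simp
  also have "\<dots> = excedances n \<pi>"
    by force
  finally show ?thesis ..
qed

end
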